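(* Let $Z:[0,T]\to\mathbb R^m$ be the driving path, $\Delta Z_{u,v}^a:=Z_v^a-Z_u^a$, and let $A\in\mathbb R^{q\times q}$, $b\in\mathbb R^q$ be the tableau of a simplified controlled Runge-Kutta method. For $\tau\in\mathcal T$ and $0\le u\le v\le T$, let $\Phi^{\mathrm{SCRK}}_{u,v}(\tau)\in\mathbb R^q$ and $a^{\mathrm{SCRK}}_{u,v}(\tau)\in\mathbb R$ denote its stage and output coefficients. Then, for $i=1,\dots,q$, $$\bigl(\Phi^{\mathrm{SCRK}}_{u,v}(\tau)\bigr)_i=\bigl(\widehat\Phi(\tau)\bigr)_i\prod_{w\in V(\tau)}\Delta Z_{u,v}^{\ell(w)},\qquad a^{\mathrm{SCRK}}_{u,v}(\tau)=\widehat a(\tau)\prod_{w\in V(\tau)}\Delta Z_{u,v}^{\ell(w)},$$ where $V(\tau)$ is the vertex set of $\tau$ and $\ell(w)\in\mathcal A=\{1,\dots,m\}$ is the label of $w$.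
   Context: $\mathcal T$ is the set of (nonplanar) rooted trees with vertices decorated by $\mathcal A=\{1,\dots,m\}$, $\mathbf 1$ is the empty tree, $[\tau_1\cdots\tau_n]_a$ is the tree obtained by joining the roots of $\tau_1,\dots,\tau_n$ to a new root decorated by $a$, $\bullet_a=[\mathbf 1]_a$. $\odot$ is the componentwise product on $\mathbb R^q$, and $\mathbf 1_q=(1,\dots,1)^\top$ is the empty product. A controlled Runge-Kutta method with coefficient matrices $\mathcal Z^{(a)}_{u,v}\in\mathbb R^{q\times q}$ and vectors $\zeta^{(a)}_{u,v}\in\mathbb R^q$ has stages $Y_i=y+\sum_{a,j}(\mathcal Z^{(a)}_{u,v})_{i,j}F_a(Y_j)$ and output $y+\sum_{a,i}(\zeta^{(a)}_{u,v})_iF_a(Y_i)$; its stage and output coefficients are defined by $\Phi_{u,v}(\mathbf 1)=\mathbf 1_q$, $a_{u,v}(\mathbf 1)=1$, and $$\Phi_{u,v}([\tau_1\cdots\tau_n]_a)=\mathcal Z^{(a)}_{u,v}\bigl(\Phi_{u,v}(\tau_1)\odot\cdots\odot\Phi_{u,v}(\tau_n)\bigr),\qquad a_{u,v}([\tau_1\cdots\tau_n]_a)=\bigl\langle\zeta^{(a)}_{u,v},\Phi_{u,v}(\tau_1)\odot\cdots\odot\Phi_{u,v}(\tau_n)\bigr\rangle.$$ The simplified method is the special case $\mathcal Z^{(a)}_{u,v}=\Delta Z^a_{u,v}A$, $\zeta^{(a)}_{u,v}=\Delta Z^a_{u,v}b$, and $\Phi^{\mathrm{SCRK}}_{u,v},a^{\mathrm{SCRK}}_{u,v}$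 denote the corresponding $\Phi_{u,v},a_{u,v}$. Scalar weights: $\widehat\Phi(\mathbf 1)=\mathbf 1_q$, $\widehat\Phi([\tau_1\cdots\tau_n]_a)=A(\widehat\Phi(\tau_1)\odot\cdots\odot\widehat\Phi(\tau_n))$, $\widehat a(\mathbf 1)=1$, $\widehat a([\tau_1\cdots\tau_n]_a)=\langle b,\widehat\Phi(\tau_1)\odot\cdots\odot\widehat\Phi(\tau_n)\rangle_{\mathbb R^q}$. *)

theory Defs
  imports "HOL-Analysis.Analysis" "HOL-Library.Multiset"
begin

section \<open>Decorated nonplanar rooted trees\<close>

text \<open>
  The branches at a vertex form a multiset, so that their order is irrelevant. The decoration
  alphabet is an index type \<open>'m\<close>; in the setting of the driving path
  it is finite and plays the role of the set of channel indices.
  \<^term>\<open>None\<close> is the empty tree.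
\<close>

datatype 'm rtree = Node (root_label: 'm) (branches: "'m rtree multiset")

type_synonym 'm tree = "'m rtree option"

abbreviation empty_tree :: "'m tree" where "empty_tree \<equiv> None"

text \<open>
  Joining the roots of a family of trees to a new root. Empty trees in the family contribute
  no branch.
\<close>

definition join :: "'m \<Rightarrow> 'm tree multiset \<Rightarrow> 'm tree" where
  "join a ts = Some (Node a (image_mset the (filter_mset (\<lambda>t. t \<noteq> empty_tree) ts)))"

lemma join_empty: "join a {#empty_tree#} = Some (Node a {#})"
  by (simp add: join_def)

lemma join_Some: "join a (image_mset Some M) = Some (Node a M)"
  by (simp add: join_def filter_mset_image_mset multiset.map_comp comp_def)

lemma tree_cases: obtains "t = empty_tree" | a ts where "t = join a ts"
proof (cases t)
  case (Some r)
  then show ?thesis using that(2) join_Some by (metis rtree.exhaust)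
qed (use that in blast)

subsection \<open>Vertices and their labels\<close>

text \<open>
  A vertex is given by the path leading to it from the root. A step of the path is a pair
  \<open>(t, k)\<close> and selects the \<open>k\<close>-th of the \<open>count M t\<close> copies of the branch \<open>t\<close> at the current
  vertex, so that vertices lying in isomorphic branches are kept apart.
\<close>

type_synonym 'm vertex = "('m rtree \<times> nat) list"

fun is_vertex :: "'m rtree \<Rightarrow> 'm vertex \<Rightarrow> bool" where
  "is_vertex r [] \<longleftrightarrow> True"
| "is_vertex r ((t, k) # w) \<longleftrightarrow> k < count (branches r) t \<and> is_vertex t w"

definition vertices :: "'m tree \<Rightarrow> 'm vertex set" where
  "vertices \<tau> = (case \<tau> of None \<Rightarrow> {} | Some r \<Rightarrow> {w. is_vertex r w})"

fun rlabel :: "'m rtree \<Rightarrow> 'm vertex \<Rightarrow> 'm" where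
  "rlabel r [] = root_label r"
| "rlabel r ((t, k) # w) = rlabel t w"

text \<open>The empty tree has no vertices, so the label is irrelevant there.\<close>

definition label :: "'m tree \<Rightarrow> 'm vertex \<Rightarrow> 'm" where
  "label \<tau> w = rlabel (the \<tau>) w"

lemma finite_is_vertex: "finite {w. is_vertex r w}"
proof (induction r)
  case (Node a M)
  have "{w. is_vertex (Node a M) w} \<subseteq>
      insert [] (\<Union>t\<in>set_mset M. \<Union>k\<in>{..<count M t}. Cons (t, k) ` {w. is_vertex t w})"
  proof
    fix w assume "w \<in> {w. is_vertex (Node a M) w}"
    then show "w \<in> insert []
        (\<Union>t\<in>set_mset M. \<Union>k\<in>{..<count M t}. Cons (t, k) ` {w. is_vertex t w})"
    proof (cases w)
      case (Cons s w')
      obtain t k where s: "s = (t, k)" by (cases s)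
      with Cons \<open>w \<in> _\<close> have "k < count M t" "is_vertex t w'" by auto
      moreover from this have "t \<in> set_mset M"
        by (metis count_inI not_less_zero)
      ultimately show ?thesis using Cons s by blast
    qed simp
  qed
  moreover have "finite (insert []
      (\<Union>t\<in>set_mset M. \<Union>k\<in>{..<count M t}. Cons (t, k) ` {w. is_vertex t w}))"
    using Node by simp
  ultimately show ?case by (rule finite_subset)
qed

lemma finite_vertices: "finite (vertices \<tau>)"
  by (auto simp: vertices_def finite_is_vertex split: option.split)

section \<open>Coefficients of a controlled Runge--Kutta method\<close>

text \<open>
  Multiplication on \<open>real ^ 'q\<close> is componentwise and its unit is the all-ones vector, so
  \<^term>\<open>prod_mset\<close> is the componentwise product of a family of vectors.

  The coefficient matrices and vectors \<open>\<Z>\<close>, \<open>\<zeta>\<close> are functions of the two times \<open>u\<close>, \<open>v\<close> and of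
  the decoration \<open>a\<close>.
\<close>

primrec stage_rtree ::
  "('m \<Rightarrow> real ^ 'q ^ 'q) \<Rightarrow> 'm rtree \<Rightarrow> real ^ 'q" where
  "stage_rtree C (Node a M) = C a *v (\<Prod>\<^sub># (image_mset (stage_rtree C) M))"

definition stage_coeff ::
  "(real \<Rightarrow> real \<Rightarrow> 'm \<Rightarrow> real ^ 'q ^ 'q) \<Rightarrow> real \<Rightarrow> real \<Rightarrow> 'm tree \<Rightarrow> real ^ 'q" where
  "stage_coeff \<Z> u v \<tau> = (case \<tau> of None \<Rightarrow> 1 | Some r \<Rightarrow> stage_rtree (\<Z> u v) r)"

definition output_coeff ::
  "(real \<Rightarrow> real \<Rightarrow> 'm \<Rightarrow> real ^ 'q ^ 'q) \<Rightarrow> (real \<Rightarrow> real \<Rightarrow> 'm \<Rightarrow> real ^ 'q) \<Rightarrow>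
    real \<Rightarrow> real \<Rightarrow> 'm tree \<Rightarrow> real" where
  "output_coeff \<Z> \<zeta> u v \<tau> = (case \<tau> of None \<Rightarrow> 1
    | Some (Node a M) \<Rightarrow> \<zeta> u v a \<bullet> (\<Prod>\<^sub># (image_mset (stage_rtree (\<Z> u v)) M)))"

lemma prod_mset_branches:
  fixes f :: "'m tree \<Rightarrow> 'b::comm_monoid_mult"
  assumes "f empty_tree = 1"
  shows "(\<Prod>r\<in>#image_mset the (filter_mset (\<lambda>t. t \<noteq> empty_tree) ts). f (Some r)) =
    (\<Prod>t\<in>#ts. f t)"
  using assms by (induction ts) auto

lemma stage_coeff_empty: "stage_coeff \<Z> u v empty_tree = 1"
  by (simp add: stage_coeff_def)

lemma stage_coeff_Some: "stage_coeff \<Z> u v (Some r) = stage_rtree (\<Z> u v) r"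
  by (simp add: stage_coeff_def)

lemma output_coeff_empty: "output_coeff \<Z> \<zeta> u v empty_tree = 1"
  by (simp add: output_coeff_def)

lemma stage_coeff_join:
  "stage_coeff \<Z> u v (join a ts) = \<Z> u v a *v (\<Prod>t\<in>#ts. stage_coeff \<Z> u v t)"
  using prod_mset_branches[of "stage_coeff \<Z> u v" ts]
  by (simp add: join_def stage_coeff_def)

lemma output_coeff_join:
  "output_coeff \<Z> \<zeta> u v (join a ts) = \<zeta> u v a \<bullet> (\<Prod>t\<in>#ts. stage_coeff \<Z> u v t)"
  using prod_mset_branches[of "stage_coeff \<Z> u v" ts]
  by (simp add: join_def stage_coeff_def output_coeff_def)

subsection \<open>The simplified method\<close>

definition incr :: "(real \<Rightarrow> real ^ 'm) \<Rightarrow> real \<Rightarrow> real \<Rightarrow> 'm \<Rightarrow> real" where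
  "incr Z u v a = Z v $ a - Z u $ a"

definition scrk_matrix ::
  "(real \<Rightarrow> real ^ 'm) \<Rightarrow> real ^ 'q ^ 'q \<Rightarrow> real \<Rightarrow> real \<Rightarrow> 'm \<Rightarrow> real ^ 'q ^ 'q" where
  "scrk_matrix Z A u v a = incr Z u v a *\<^sub>R A"

definition scrk_vector ::
  "(real \<Rightarrow> real ^ 'm) \<Rightarrow> real ^ 'q \<Rightarrow> real \<Rightarrow> real \<Rightarrow> 'm \<Rightarrow> real ^ 'q" where
  "scrk_vector Z b u v a = incr Z u v a *\<^sub>R b"

definition scrk_stage ::
  "(real \<Rightarrow> real ^ 'm) \<Rightarrow> real ^ 'q ^ 'q \<Rightarrow> real \<Rightarrow> real \<Rightarrow> 'm tree \<Rightarrow> real ^ 'q" where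
  "scrk_stage Z A = stage_coeff (scrk_matrix Z A)"

definition scrk_output ::
  "(real \<Rightarrow> real ^ 'm) \<Rightarrow> real ^ 'q ^ 'q \<Rightarrow> real ^ 'q \<Rightarrow> real \<Rightarrow> real \<Rightarrow> 'm tree \<Rightarrow> real" where
  "scrk_output Z A b = output_coeff (scrk_matrix Z A) (scrk_vector Z b)"

section \<open>Scalar weights\<close>

primrec weight_rtree :: "real ^ 'q ^ 'q \<Rightarrow> 'm rtree \<Rightarrow> real ^ 'q" where
  "weight_rtree A (Node a M) = A *v (\<Prod>\<^sub># (image_mset (weight_rtree A) M))"

definition stage_weight :: "real ^ 'q ^ 'q \<Rightarrow> 'm tree \<Rightarrow> real ^ 'q" where
  "stage_weight A \<tau> = (case \<tau> of None \<Rightarrow> 1 | Some r \<Rightarrow> weight_rtree A r)"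

definition output_weight :: "real ^ 'q ^ 'q \<Rightarrow> real ^ 'q \<Rightarrow> 'm tree \<Rightarrow> real" where
  "output_weight A b \<tau> = (case \<tau> of None \<Rightarrow> 1
    | Some (Node a M) \<Rightarrow> b \<bullet> (\<Prod>\<^sub># (image_mset (weight_rtree A) M)))"

lemma stage_weight_empty: "stage_weight A empty_tree = 1"
  by (simp add: stage_weight_def)

lemma stage_weight_Some: "stage_weight A (Some r) = weight_rtree A r"
  by (simp add: stage_weight_def)

lemma output_weight_empty: "output_weight A b empty_tree = 1"
  by (simp add: output_weight_def)

lemma stage_weight_join:
  "stage_weight A (join a ts) = A *v (\<Prod>t\<in>#ts. stage_weight A t)"
  using prod_mset_branches[of "stage_weight A" ts]
  by (simp add: join_def stage_weight_def)

lemma output_weight_join: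
  "output_weight A b (join a ts) = b \<bullet> (\<Prod>t\<in>#ts. stage_weight A t)"
  using prod_mset_branches[of "stage_weight A" ts]
  by (simp add: join_def stage_weight_def output_weight_def)

end

theory Submission
  imports Defs
begin

text \<open>
  The stage coefficient of a tree is linear in the coefficient matrix attached to each vertex, and
  each vertex enters exactly once. Scaling the matrix at every vertex of label \<open>a\<close> by a number
  \<open>c a\<close> therefore scales the coefficient of \<open>r\<close> by the product of \<open>c\<close> over the labels of all
  vertices of \<open>r\<close>. The simplified method is the instance in which the common matrix \<open>A\<close> is scaled by
  the increments, and the scalar weights are the coefficients for the unscaled \<open>A\<close>.

  The formal argument turns on the fact that the vertex product \<open>P\<close> obeys a recursion along
  the branches, as the coefficients do: \<open>P (Node a M) = c a * (\<Prod>r\<in>#M. P r)\<close>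
  (\<open>vertex_prod_Node\<close>). Given this, structural induction yields the stage identity
  (\<open>stage_rtree_scaled\<close>), since scalars can be pulled out of componentwise products
  (\<open>prod_mset_scaleR\<close>) and past a matrix. The output coefficient differs from the stage coefficient
  only in what happens at the root, so it requires no further induction.
\<close>

definition vertex_prod :: "('m \<Rightarrow> 'b::comm_monoid_mult) \<Rightarrow> 'm rtree \<Rightarrow> 'b" where
  "vertex_prod c r = (\<Prod>w\<in>{w. is_vertex r w}. c (rlabel r w))"

lemma vertices_Node:
  "{w. is_vertex (Node a M) w} = insert []
     (\<Union>s\<in>(SIGMA t:set_mset M. {..<count M t}). Cons s ` {w. is_vertex (fst s) w})"
    (is "?L = ?R")
proof (rule set_eqI)
  fix w show "w \<in> ?L \<longleftrightarrow> w \<in> ?R"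
  proof (cases w)
    case (Cons s w')
    obtain t k where s: "s = (t, k)" by (cases s)
    have "t \<in># M" if "k < count M t"
      using that by (metis count_inI not_less_zero)
    then show ?thesis using Cons s by auto
  qed simp
qed

text \<open>
  Every vertex other than the root lies in exactly one copy of one branch. The copies of a
  branch \<open>t\<close> give equal factors, so together they contribute a power with exponent \<open>count M t\<close>,
  which is also the contribution of \<open>t\<close> to the multiset product.
\<close>

lemma vertex_prod_Node:
  fixes c :: "'m \<Rightarrow> 'b::comm_monoid_mult"
  shows "vertex_prod c (Node a M) = c a * (\<Prod>r\<in>#M. vertex_prod c r)"
proof -
  let ?I = "SIGMA t:set_mset M. {..<count M t}"
  let ?V = "\<lambda>s. Cons s ` {w. is_vertex (fst s) w}"
  let ?f = "\<lambda>w. c (rlabel (Node a M) w)"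
  have fin: "finite ?I" "finite (?V s)" for s :: "'m rtree \<times> nat"
    by (simp_all add: finite_is_vertex)
  have branch: "prod ?f (?V s) = vertex_prod c (fst s)" for s
    by (cases s) (simp add: vertex_prod_def prod.reindex)
  have "vertex_prod c (Node a M) = c a * prod ?f (\<Union>s\<in>?I. ?V s)"
    unfolding vertex_prod_def vertices_Node
    by (subst prod.insert) (use fin in auto)
  also have "prod ?f (\<Union>s\<in>?I. ?V s) = (\<Prod>s\<in>?I. prod ?f (?V s))"
    by (rule prod.UNION_disjoint) (use fin in auto)
  also have "\<dots> = (\<Prod>(t, k)\<in>?I. vertex_prod c t)"
    by (simp add: branch case_prod_unfold)
  also have "\<dots> = (\<Prod>t\<in>set_mset M. vertex_prod c t ^ count M t)"
    by (subst prod.Sigma [symmetric]) simp_all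
  also have "\<dots> = (\<Prod>r\<in>#M. vertex_prod c r)"
    by (simp add: image_prod_mset_multiplicity)
  finally show ?thesis .
qed

lemma prod_mset_scaleR:
  fixes g :: "'a \<Rightarrow> real ^ 'q"
  shows "(\<Prod>x\<in>#M. p x *\<^sub>R g x) = (\<Prod>x\<in>#M. p x) *\<^sub>R (\<Prod>x\<in>#M. g x)"
  by (induction M) (simp_all add: vec_eq_iff)

text \<open>
  At the root, the branches contribute the product of their vertex products by induction, and the
  scaled matrix contributes the one missing factor \<open>c a\<close>.
\<close>

lemma stage_rtree_scaled:
  fixes A :: "real ^ 'q ^ 'q"
  shows "stage_rtree (\<lambda>a. c a *\<^sub>R A) r = vertex_prod c r *\<^sub>R weight_rtree A r"
proof (induction r)
  case (Node a M)
  have "(\<Prod>r\<in>#M. stage_rtree (\<lambda>a. c a *\<^sub>R A) r) =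
      (\<Prod>r\<in>#M. vertex_prod c r) *\<^sub>R (\<Prod>r\<in>#M. weight_rtree A r)"
    using Node by (simp add: prod_mset_scaleR cong: image_mset_cong)
  then show ?case
    by (simp add: vertex_prod_Node matrix_vector_mult_scaleR
        flip: scaleR_matrix_vector_assoc)
qed

theorem proposition5p5:
  fixes T :: real
    and Z :: "real \<Rightarrow> real ^ 'm"
    and A :: "real ^ 'q ^ 'q"
    and b :: "real ^ 'q"
    and \<tau> :: "'m tree"
    and u v :: real
  assumes "0 \<le> u" and "u \<le> v" and "v \<le> T"
  shows "(\<forall>i. scrk_stage Z A u v \<tau> $ i =
              stage_weight A \<tau> $ i * (\<Prod>w\<in>vertices \<tau>. incr Z u v (label \<tau> w)))
       \<and> scrk_output Z A b u v \<tau> =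
              output_weight A b \<tau> * (\<Prod>w\<in>vertices \<tau>. incr Z u v (label \<tau> w))"
proof (cases \<tau>)
  case None
  then show ?thesis
    by (simp add: scrk_stage_def scrk_output_def stage_coeff_empty output_coeff_empty
        stage_weight_empty output_weight_empty vertices_def)
next
  case (Some r)
  let ?c = "incr Z u v"
  obtain a M where r: "r = Node a M" by (cases r)
  have vp: "(\<Prod>w\<in>vertices \<tau>. ?c (label \<tau> w)) = vertex_prod ?c r"
    by (simp add: Some vertices_def label_def vertex_prod_def)
  have matrix: "scrk_matrix Z A u v = (\<lambda>a. ?c a *\<^sub>R A)"
    by (simp add: fun_eq_iff scrk_matrix_def)
  have "scrk_stage Z A u v \<tau> = vertex_prod ?c r *\<^sub>R stage_weight A \<tau>"
    by (simp add: Some scrk_stage_def stage_coeff_Some stage_weight_Some matrix stage_rtree_scaled)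
  moreover have "(\<Prod>r\<in>#M. stage_rtree (\<lambda>a. ?c a *\<^sub>R A) r) =
      (\<Prod>r\<in>#M. vertex_prod ?c r) *\<^sub>R (\<Prod>r\<in>#M. weight_rtree A r)"
    by (simp only: stage_rtree_scaled prod_mset_scaleR)
  then have "scrk_output Z A b u v \<tau> = output_weight A b \<tau> * vertex_prod ?c r"
    by (simp add: Some r scrk_output_def output_coeff_def output_weight_def scrk_vector_def
        matrix vertex_prod_Node)
  ultimately show ?thesis
    by (simp add: vp mult.commute)
qed

end
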